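(* Let $(\Xi,\rho,\theta,\Sigma)$ be a continuous groupoid action and consider the following conditions. (i) $\Sigma$ is not the union of two proper invariant closed subsets. (i') Any two open non-void invariant subsets of $\Sigma$ have non-trivial (i.e. non-empty) intersection. (ii) Each non-empty open invariant subset of $\Sigma$ is dense. (iii) For every non-void open $U,V\subset\Sigma$ one has $\widetilde\Xi_U^V\neq\emptyset$ (recurrent transitivity). (iv) Each invariant subset of $\Sigma$ is either dense or nowhere dense (topological transitivity). Then: 1. Transitivity implies pointwise transitivity, and pointwise transitivity implies (iii). 2. One has $(iv)\Rightarrow(iii)\Rightarrow(ii)\Rightarrow(i')\Leftrightarrow(i)$. None of the other implications among these conditions holds in general: there exist continuous groupoid actions satisfying (i) but not (ii), continuous groupoid actions satisfying (ii) but not (iii), and continuous groupoid actions satisfying (iii) but not (iv). Moreover, pointwise transitivity does not imply topological transitivity (iv): there is a pointwise transitive continuous groupoid action for which (iv) fails. 3. If the groupoid $\Xi$ is open, the conditions (i), (i'), (ii), (iii), (iv) are all equivalent.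
   Context: All topological spaces are Hausdorff. A groupoid $\Xi$ is a small category in which all arrows are invertible; $X=\Xi^{(0)}$ is its unit space, $d,r:\Xi\to X$ are the source and range maps, and $\xi\eta$ is defined iff $d(\xi)=r(\eta)$. A topological groupoid is a groupoid with a (Hausdorff) topology making inversion and multiplication continuous (composable pairs carry the topology induced from $\Xi\times\Xi$); $X$ has the subspace topology. $\Xi$ is called open if $d:\Xi\to X$ is an open map. For $x\in X$, $\Xi_x=d^{-1}(\{x\})$. A continuous groupoid action $(\Xi,\rho,\theta,\Sigma)$ consists of a topological groupoid $\Xi$, a Hausdorff space $\Sigma$, a continuous surjection $\rho:\Sigma\to X$ (the anchor) and a continuous map $\theta:\{(\xi,\sigma)\in\Xi\times\Sigma: d(\xi)=\rho(\sigma)\}\to\Sigma$, $\theta_\xi(\sigma)=\xi\bullet\sigma$, with $\rho(\sigma)\bullet\sigma=\sigma$ and: if $d(\xi)=r(\eta)$ and $d(\eta)=\rho(\sigma)$ then $d(\xi)=\rho(\eta\bullet\sigma)$ and $(\xi\eta)\bullet\sigma=\xi\bullet(\eta\bullet\sigma)$. For $M\subset\Sigma$, $\xi\bullet M=\{\xi\bullet\sigma:\sigma\in M,\ \rho(\sigma)=d(\xi)\}$. $M$ is invariant if $\xi\bullet M\subset M$ for all $\xi\in\Xi$. The orbit of $\sigma$ is $\{\xi\bullet\sigma:\xi\in\Xi_{\rho(\sigma)}\}$. The recurrence set is $\widetilde\Xi_M^N=\{\xi\in\Xi:(\xi\bullet M)\cap N\neq\emptyset\}$ for $M,N\subset\Sigma$.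 The action is transitive if there is just one orbit, and pointwise transitive if there is a dense orbit. *)

theory Defs
  imports "HOL-Analysis.Analysis"
begin

section \<open>Topological groupoids\<close>

text \<open>A groupoid is given by its arrows only: objects are identified with their identity arrows, so
  the source and range maps take values in the arrows. The set of arrows is the carrier of the
  topology. The operations are total functions, constrained only on arrows (and, for
  multiplication, only on composable pairs).\<close>

record 'g top_groupoid =
  arr_top :: "'g topology"
  src :: "'g \<Rightarrow> 'g"
  rng :: "'g \<Rightarrow> 'g"
  mul :: "'g \<Rightarrow> 'g \<Rightarrow> 'g"
  iv :: "'g \<Rightarrow> 'g"

definition arrows :: "'g top_groupoid \<Rightarrow> 'g set" where
  "arrows G = topspace (arr_top G)"

definition units :: "'g top_groupoid \<Rightarrow> 'g set" where
  "units G = src G ` arrows G"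

definition unit_top :: "'g top_groupoid \<Rightarrow> 'g topology" where
  "unit_top G = subtopology (arr_top G) (units G)"

definition groupoid :: "'g top_groupoid \<Rightarrow> bool" where
  "groupoid G \<longleftrightarrow>
     (\<forall>\<xi>\<in>arrows G. src G \<xi> \<in> arrows G \<and> rng G \<xi> \<in> arrows G \<and>
        src G (src G \<xi>) = src G \<xi> \<and> rng G (src G \<xi>) = src G \<xi> \<and>
        src G (rng G \<xi>) = rng G \<xi> \<and> rng G (rng G \<xi>) = rng G \<xi>) \<and>
     (\<forall>\<xi>\<in>arrows G. \<forall>\<eta>\<in>arrows G. src G \<xi> = rng G \<eta> \<longrightarrow>
        mul G \<xi> \<eta> \<in> arrows G \<and> src G (mul G \<xi> \<eta>) = src G \<eta> \<and> rng G (mul G \<xi> \<eta>) = rng G \<xi>) \<and>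
     (\<forall>\<xi>\<in>arrows G. \<forall>\<eta>\<in>arrows G. \<forall>\<zeta>\<in>arrows G. src G \<xi> = rng G \<eta> \<longrightarrow> src G \<eta> = rng G \<zeta> \<longrightarrow>
        mul G (mul G \<xi> \<eta>) \<zeta> = mul G \<xi> (mul G \<eta> \<zeta>)) \<and>
     (\<forall>\<xi>\<in>arrows G. mul G (rng G \<xi>) \<xi> = \<xi> \<and> mul G \<xi> (src G \<xi>) = \<xi>) \<and>
     (\<forall>\<xi>\<in>arrows G. iv G \<xi> \<in> arrows G \<and> src G (iv G \<xi>) = rng G \<xi> \<and> rng G (iv G \<xi>) = src G \<xi> \<and>
        mul G (iv G \<xi>) \<xi> = src G \<xi> \<and> mul G \<xi> (iv G \<xi>) = rng G \<xi>)"

definition topological_groupoid :: "'g top_groupoid \<Rightarrow> bool" where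
  "topological_groupoid G \<longleftrightarrow>
     groupoid G \<and> Hausdorff_space (arr_top G) \<and>
     continuous_map (arr_top G) (arr_top G) (iv G) \<and>
     continuous_map
       (subtopology (prod_topology (arr_top G) (arr_top G)) {(\<xi>, \<eta>). src G \<xi> = rng G \<eta>})
       (arr_top G) (\<lambda>(\<xi>, \<eta>). mul G \<xi> \<eta>)"

definition open_groupoid :: "'g top_groupoid \<Rightarrow> bool" where
  "open_groupoid G \<longleftrightarrow> open_map (arr_top G) (unit_top G) (src G)"

section \<open>Groupoid actions\<close>

record ('g, 's) groupoid_action =
  gpd :: "'g top_groupoid"
  spc :: "'s topology"
  anchor :: "'s \<Rightarrow> 'g"
  act :: "'g \<Rightarrow> 's \<Rightarrow> 's"

definition points :: "('g, 's) groupoid_action \<Rightarrow> 's set" where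
  "points A = topspace (spc A)"

definition continuous_groupoid_action :: "('g, 's) groupoid_action \<Rightarrow> bool" where
  "continuous_groupoid_action A \<longleftrightarrow>
     topological_groupoid (gpd A) \<and> Hausdorff_space (spc A) \<and>
     continuous_map (spc A) (unit_top (gpd A)) (anchor A) \<and>
     anchor A ` points A = units (gpd A) \<and>
     continuous_map
       (subtopology (prod_topology (arr_top (gpd A)) (spc A)) {(\<xi>, \<sigma>). src (gpd A) \<xi> = anchor A \<sigma>})
       (spc A) (\<lambda>(\<xi>, \<sigma>). act A \<xi> \<sigma>) \<and>
     (\<forall>\<sigma>\<in>points A. act A (anchor A \<sigma>) \<sigma> = \<sigma>) \<and>
     (\<forall>\<xi>\<in>arrows (gpd A). \<forall>\<eta>\<in>arrows (gpd A). \<forall>\<sigma>\<in>points A.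
        src (gpd A) \<xi> = rng (gpd A) \<eta> \<longrightarrow> src (gpd A) \<eta> = anchor A \<sigma> \<longrightarrow>
          src (gpd A) \<xi> = anchor A (act A \<eta> \<sigma>) \<and>
          act A (mul (gpd A) \<xi> \<eta>) \<sigma> = act A \<xi> (act A \<eta> \<sigma>))"

definition translate :: "('g, 's) groupoid_action \<Rightarrow> 'g \<Rightarrow> 's set \<Rightarrow> 's set" where
  "translate A \<xi> M = {act A \<xi> \<sigma> | \<sigma>. \<sigma> \<in> M \<and> anchor A \<sigma> = src (gpd A) \<xi>}"

definition invariant :: "('g, 's) groupoid_action \<Rightarrow> 's set \<Rightarrow> bool" where
  "invariant A M \<longleftrightarrow> M \<subseteq> points A \<and> (\<forall>\<xi>\<in>arrows (gpd A). translate A \<xi> M \<subseteq> M)"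

definition orbit :: "('g, 's) groupoid_action \<Rightarrow> 's \<Rightarrow> 's set" where
  "orbit A \<sigma> = {act A \<xi> \<sigma> | \<xi>. \<xi> \<in> arrows (gpd A) \<and> src (gpd A) \<xi> = anchor A \<sigma>}"

definition recurrence_set :: "('g, 's) groupoid_action \<Rightarrow> 's set \<Rightarrow> 's set \<Rightarrow> 'g set" where
  "recurrence_set A M N = {\<xi> \<in> arrows (gpd A). translate A \<xi> M \<inter> N \<noteq> {}}"

section \<open>Transitivity conditions\<close>

definition dense_in_space :: "'s topology \<Rightarrow> 's set \<Rightarrow> bool" where
  "dense_in_space S M \<longleftrightarrow> S closure_of M = topspace S"

definition nowhere_dense_in_space :: "'s topology \<Rightarrow> 's set \<Rightarrow> bool" where
  "nowhere_dense_in_space S M \<longleftrightarrow> S interior_of (S closure_of M) = {}"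

definition transitive_action :: "('g, 's) groupoid_action \<Rightarrow> bool" where
  "transitive_action A \<longleftrightarrow> (\<exists>!Q. \<exists>\<sigma>\<in>points A. Q = orbit A \<sigma>)"

definition pointwise_transitive :: "('g, 's) groupoid_action \<Rightarrow> bool" where
  "pointwise_transitive A \<longleftrightarrow> (\<exists>\<sigma>\<in>points A. dense_in_space (spc A) (orbit A \<sigma>))"

definition not_union_of_closed_invariant :: "('g, 's) groupoid_action \<Rightarrow> bool" where
  "not_union_of_closed_invariant A \<longleftrightarrow>
     \<not> (\<exists>C D. closedin (spc A) C \<and> invariant A C \<and> C \<noteq> points A \<and>
             closedin (spc A) D \<and> invariant A D \<and> D \<noteq> points A \<and> points A = C \<union> D)"

definition open_invariant_intersect :: "('g, 's) groupoid_action \<Rightarrow> bool" where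
  "open_invariant_intersect A \<longleftrightarrow>
     (\<forall>U V. openin (spc A) U \<and> invariant A U \<and> U \<noteq> {} \<and>
            openin (spc A) V \<and> invariant A V \<and> V \<noteq> {} \<longrightarrow> U \<inter> V \<noteq> {})"

definition open_invariant_dense :: "('g, 's) groupoid_action \<Rightarrow> bool" where
  "open_invariant_dense A \<longleftrightarrow>
     (\<forall>U. openin (spc A) U \<and> invariant A U \<and> U \<noteq> {} \<longrightarrow> dense_in_space (spc A) U)"

definition recurrently_transitive :: "('g, 's) groupoid_action \<Rightarrow> bool" where
  "recurrently_transitive A \<longleftrightarrow>
     (\<forall>U V. openin (spc A) U \<and> U \<noteq> {} \<and> openin (spc A) V \<and> V \<noteq> {} \<longrightarrow> recurrence_set A U V \<noteq> {})"

definition topologically_transitive :: "('g, 's) groupoid_action \<Rightarrow> bool" where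
  "topologically_transitive A \<longleftrightarrow>
     (\<forall>M. invariant A M \<longrightarrow> dense_in_space (spc A) M \<or> nowhere_dense_in_space (spc A) M)"

end

theory Submission
  imports Defs
begin

text \<open>
  Every condition in the theorem depends on the groupoid only through its orbits: inverses and
  composition make \<open>\<tau> \<in> orbit A \<sigma>\<close> an equivalence relation on the points, the invariant sets are the
  unions of orbits, and the recurrence set of \<open>U\<close> and \<open>V\<close> is non-empty exactly when some orbit meets
  both. The implications that hold for all actions follow from this by taking complements and
  saturations (unions of all orbits meeting a given set).

  Openness of the groupoid enters through one fact: it makes saturations of open sets open
  (\<open>openin_saturation\<close>). Then condition (i') yields (iv). Indeed, if an invariant set \<open>M\<close> is
  neither dense nor nowhere dense, let \<open>U\<close> be the interior of its closure and \<open>V\<close> the complement of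
  its closure. The saturations of \<open>U\<close> and \<open>V\<close> are open, invariant and non-empty, so they meet, and
  hence \<open>U\<close> meets the open saturation of \<open>V\<close>. As \<open>M\<close> is dense in \<open>U\<close>, it meets this saturation too,
  and by invariance it meets \<open>V\<close>, which is absurd.

  For the counterexamples, any equivalence relation \<open>R\<close> on a Hausdorff space is a topological
  groupoid with the topology induced from the square, however wild its classes are, and it acts on
  the space with the classes as orbits. On the real line, three partitions suffice:
  \<^item> \<open>{..0}\<close> and \<open>{0<..}\<close>: the only non-empty open invariant sets are \<open>{0<..}\<close>, which is not dense,
    and the line. This separates (i) from (ii).
  \<^item> \<open>{..<0} \<union> {2}\<close> and \<open>{0..} - {2}\<close>: each class has a point in the closure of the other's interior,
    so the line is the only non-empty open invariant set; but no orbit meets both \<open>{..<0}\<close> and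
    \<open>{0<..<1}\<close>. This separates (ii) from (iii).
  \<^item> the rationals and all irrational singletons: the rationals are a dense orbit, but the
    irrationals in the unit interval form an invariant set that is neither dense nor nowhere dense.
    This separates pointwise transitivity, and with it (iii), from (iv).
\<close>

section \<open>Orbits and saturations\<close>

definition saturation :: "('g, 's) groupoid_action \<Rightarrow> 's set \<Rightarrow> 's set" where
  "saturation A M = (\<Union>\<sigma>\<in>M. orbit A \<sigma>)"

lemma dense_in_space_iff:
  "dense_in_space S M \<longleftrightarrow> (\<forall>V. openin S V \<and> V \<noteq> {} \<longrightarrow> M \<inter> V \<noteq> {})"
  unfolding dense_in_space_def dense_intersects_open by (auto simp: Int_commute)

lemma dense_meets_open:
  assumes "dense_in_space S M" "openin S V" "V \<noteq> {}"
  shows "M \<inter> V \<noteq> {}"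
  using assms unfolding dense_in_space_iff by simp

lemma invariant_iff_orbits:
  "invariant A M \<longleftrightarrow> M \<subseteq> points A \<and> (\<forall>\<sigma>\<in>M. orbit A \<sigma> \<subseteq> M)"
  unfolding invariant_def translate_def orbit_def by fastforce

lemma recurrence_set_nonempty_iff:
  "recurrence_set A U V \<noteq> {} \<longleftrightarrow> (\<exists>\<sigma>\<in>U. \<exists>\<tau>\<in>V. \<tau> \<in> orbit A \<sigma>)"
  unfolding recurrence_set_def translate_def orbit_def by fastforce

locale continuous_action =
  fixes A :: "('g, 's) groupoid_action"
  assumes continuous_action: "continuous_groupoid_action A"
begin

lemma groupoid: "groupoid (gpd A)"
  using continuous_action unfolding continuous_groupoid_action_def topological_groupoid_def by blast

lemma continuous_map_anchor: "continuous_map (spc A) (unit_top (gpd A)) (anchor A)"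
  using continuous_action unfolding continuous_groupoid_action_def by blast

lemma continuous_map_act:
  "continuous_map
     (subtopology (prod_topology (arr_top (gpd A)) (spc A)) {(\<xi>, \<sigma>). src (gpd A) \<xi> = anchor A \<sigma>})
     (spc A) (\<lambda>(\<xi>, \<sigma>). act A \<xi> \<sigma>)"
  using continuous_action unfolding continuous_groupoid_action_def by blast

lemma anchor_arrow:
  assumes "\<sigma> \<in> points A"
  shows "anchor A \<sigma> \<in> arrows (gpd A)" "src (gpd A) (anchor A \<sigma>) = anchor A \<sigma>"
proof -
  have "anchor A \<sigma> \<in> src (gpd A) ` arrows (gpd A)"
    using continuous_action assms unfolding continuous_groupoid_action_def units_def by blast
  then show "anchor A \<sigma> \<in> arrows (gpd A)" "src (gpd A) (anchor A \<sigma>) = anchor A \<sigma>"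
    using groupoid unfolding groupoid_def by auto
qed

lemma act_anchor: "\<sigma> \<in> points A \<Longrightarrow> act A (anchor A \<sigma>) \<sigma> = \<sigma>"
  using continuous_action unfolding continuous_groupoid_action_def by blast

lemma iv_arrow:
  assumes "\<xi> \<in> arrows (gpd A)"
  shows "iv (gpd A) \<xi> \<in> arrows (gpd A)" "src (gpd A) (iv (gpd A) \<xi>) = rng (gpd A) \<xi>"
    "rng (gpd A) (iv (gpd A) \<xi>) = src (gpd A) \<xi>"
    "mul (gpd A) (iv (gpd A) \<xi>) \<xi> = src (gpd A) \<xi>"
  using groupoid assms unfolding groupoid_def by blast+

lemma act_in_points:
  assumes "\<xi> \<in> arrows (gpd A)" "\<sigma> \<in> points A" "src (gpd A) \<xi> = anchor A \<sigma>"
  shows "act A \<xi> \<sigma> \<in> points A"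
proof -
  have "(\<lambda>(\<xi>, \<sigma>). act A \<xi> \<sigma>) (\<xi>, \<sigma>) \<in> topspace (spc A)"
    using continuous_map_image_subset_topspace[OF continuous_map_act] assms
    unfolding points_def arrows_def image_subset_iff by (elim bspec) simp
  then show ?thesis
    by (simp add: points_def)
qed

lemma act_mul:
  assumes "\<xi> \<in> arrows (gpd A)" "\<eta> \<in> arrows (gpd A)" "\<sigma> \<in> points A"
    "src (gpd A) \<xi> = rng (gpd A) \<eta>" "src (gpd A) \<eta> = anchor A \<sigma>"
  shows "src (gpd A) \<xi> = anchor A (act A \<eta> \<sigma>)"
    "act A (mul (gpd A) \<xi> \<eta>) \<sigma> = act A \<xi> (act A \<eta> \<sigma>)"
  using continuous_action assms unfolding continuous_groupoid_action_def by blast+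

lemma anchor_act:
  assumes "\<xi> \<in> arrows (gpd A)" "\<sigma> \<in> points A" "src (gpd A) \<xi> = anchor A \<sigma>"
  shows "anchor A (act A \<xi> \<sigma>) = rng (gpd A) \<xi>"
  using act_mul(1)[of "iv (gpd A) \<xi>" \<xi> \<sigma>] iv_arrow assms by simp

lemma act_iv_act:
  assumes "\<xi> \<in> arrows (gpd A)" "\<sigma> \<in> points A" "src (gpd A) \<xi> = anchor A \<sigma>"
  shows "act A (iv (gpd A) \<xi>) (act A \<xi> \<sigma>) = \<sigma>"
  using act_mul(2)[of "iv (gpd A) \<xi>" \<xi> \<sigma>] iv_arrow assms act_anchor by simp

lemma orbit_subset_points: "\<sigma> \<in> points A \<Longrightarrow> orbit A \<sigma> \<subseteq> points A"
  unfolding orbit_def using act_in_points by auto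

lemma orbit_refl: "\<sigma> \<in> points A \<Longrightarrow> \<sigma> \<in> orbit A \<sigma>"
  unfolding orbit_def using act_anchor anchor_arrow by force

lemma orbit_sym:
  assumes "\<sigma> \<in> points A" "\<tau> \<in> orbit A \<sigma>"
  shows "\<sigma> \<in> orbit A \<tau>"
proof -
  obtain \<xi> where \<xi>: "\<xi> \<in> arrows (gpd A)" "src (gpd A) \<xi> = anchor A \<sigma>" "\<tau> = act A \<xi> \<sigma>"
    using assms(2) unfolding orbit_def by blast
  then have "\<sigma> = act A (iv (gpd A) \<xi>) \<tau>" "src (gpd A) (iv (gpd A) \<xi>) = anchor A \<tau>"
    using act_iv_act anchor_act iv_arrow assms(1) by simp_all
  then show ?thesis
    unfolding orbit_def using iv_arrow(1)[OF \<xi>(1)] by blast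
qed

lemma orbit_trans:
  assumes "\<sigma> \<in> points A" "\<tau> \<in> orbit A \<sigma>" "\<upsilon> \<in> orbit A \<tau>"
  shows "\<upsilon> \<in> orbit A \<sigma>"
proof -
  obtain \<eta> where \<eta>: "\<eta> \<in> arrows (gpd A)" "src (gpd A) \<eta> = anchor A \<sigma>" "\<tau> = act A \<eta> \<sigma>"
    using assms(2) unfolding orbit_def by blast
  obtain \<xi> where \<xi>: "\<xi> \<in> arrows (gpd A)" "src (gpd A) \<xi> = anchor A \<tau>" "\<upsilon> = act A \<xi> \<tau>"
    using assms(3) unfolding orbit_def by blast
  have comp: "src (gpd A) \<xi> = rng (gpd A) \<eta>"
    using anchor_act \<xi> \<eta> assms(1) by simp
  then have "mul (gpd A) \<xi> \<eta> \<in> arrows (gpd A)" "src (gpd A) (mul (gpd A) \<xi> \<eta>) = src (gpd A) \<eta>"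
    using groupoid \<xi>(1) \<eta>(1) unfolding groupoid_def by blast+
  moreover have "\<upsilon> = act A (mul (gpd A) \<xi> \<eta>) \<sigma>"
    using act_mul(2)[OF \<xi>(1) \<eta>(1) assms(1) comp \<eta>(2)] \<xi>(3) \<eta>(3) by simp
  ultimately show ?thesis
    unfolding orbit_def using \<eta>(2) by (intro CollectI exI[of _ "mul (gpd A) \<xi> \<eta>"]) simp
qed

lemma invariant_saturation:
  assumes "M \<subseteq> points A"
  shows "invariant A (saturation A M)"
  unfolding invariant_iff_orbits saturation_def
proof (intro conjI ballI subsetI)
  fix \<tau> assume "\<tau> \<in> (\<Union>\<sigma>\<in>M. orbit A \<sigma>)"
  then obtain \<sigma> where \<sigma>: "\<sigma> \<in> M" "\<tau> \<in> orbit A \<sigma>"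
    by blast
  then have point: "\<sigma> \<in> points A"
    using assms by blast
  show "\<tau> \<in> points A"
    using orbit_subset_points[OF point] \<sigma>(2) by (rule subsetD)
  show "\<upsilon> \<in> (\<Union>\<sigma>\<in>M. orbit A \<sigma>)" if "\<upsilon> \<in> orbit A \<tau>" for \<upsilon>
    using \<sigma>(1) orbit_trans[OF point \<sigma>(2) that] by (rule UN_I)
qed

lemma subset_saturation: "M \<subseteq> points A \<Longrightarrow> M \<subseteq> saturation A M"
  unfolding saturation_def using orbit_refl by blast

lemma invariant_complement:
  assumes "invariant A M"
  shows "invariant A (points A - M)"
  unfolding invariant_iff_orbits
proof (intro conjI ballI subsetI)
  fix \<sigma> \<tau> assume \<sigma>: "\<sigma> \<in> points A - M" and \<tau>: "\<tau> \<in> orbit A \<sigma>"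
  have "\<tau> \<in> points A" "\<sigma> \<in> orbit A \<tau>"
    using orbit_subset_points[of \<sigma>] orbit_sym[of \<sigma> \<tau>] \<sigma> \<tau> by auto
  then show "\<tau> \<in> points A - M"
    using assms \<sigma> unfolding invariant_iff_orbits by auto
qed auto

lemma openin_subset_points: "openin (spc A) U \<Longrightarrow> U \<subseteq> points A"
  unfolding points_def by (rule openin_subset)

section \<open>Implications valid for all actions\<close>

lemma transitive_imp_pointwise_transitive:
  assumes "transitive_action A"
  shows "pointwise_transitive A"
proof -
  obtain \<sigma> where \<sigma>: "\<sigma> \<in> points A" "\<And>\<tau>. \<tau> \<in> points A \<Longrightarrow> orbit A \<tau> = orbit A \<sigma>"
    using assms unfolding transitive_action_def by metis
  then have "orbit A \<sigma> = points A"
    using orbit_refl orbit_subset_points by blast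
  then show ?thesis
    unfolding pointwise_transitive_def dense_in_space_def points_def using \<sigma>(1)
    by (metis closure_of_topspace points_def)
qed

lemma pointwise_transitive_imp_recurrently_transitive:
  assumes "pointwise_transitive A"
  shows "recurrently_transitive A"
  unfolding recurrently_transitive_def recurrence_set_nonempty_iff
proof (intro allI impI, elim conjE)
  fix U V
  assume U: "openin (spc A) U" "U \<noteq> {}" and V: "openin (spc A) V" "V \<noteq> {}"
  obtain \<sigma> where \<sigma>: "\<sigma> \<in> points A" "dense_in_space (spc A) (orbit A \<sigma>)"
    using assms unfolding pointwise_transitive_def by blast
  obtain u v where uv: "u \<in> U" "u \<in> orbit A \<sigma>" "v \<in> V" "v \<in> orbit A \<sigma>"
    using dense_meets_open[OF \<sigma>(2) U] dense_meets_open[OF \<sigma>(2) V] by auto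
  have "u \<in> points A"
    using orbit_subset_points[OF \<sigma>(1)] uv(2) by (rule subsetD)
  then have "v \<in> orbit A u"
    using orbit_sym[OF \<sigma>(1) uv(2)] uv(4) by (rule orbit_trans)
  then show "\<exists>\<sigma>\<in>U. \<exists>\<tau>\<in>V. \<tau> \<in> orbit A \<sigma>"
    using uv by blast
qed

text \<open>The saturation of a non-empty open set contains that set, so it cannot be nowhere dense and
  must be dense.\<close>

lemma topologically_transitive_imp_recurrently_transitive:
  assumes "topologically_transitive A"
  shows "recurrently_transitive A"
  unfolding recurrently_transitive_def recurrence_set_nonempty_iff
proof (intro allI impI, elim conjE)
  fix U V
  assume U: "openin (spc A) U" "U \<noteq> {}" and V: "openin (spc A) V" "V \<noteq> {}"
  let ?S = "saturation A U"
  note U_points = openin_subset_points[OF U(1)]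
  note S = subset_saturation[OF U_points] invariant_saturation[OF U_points]
  then have "?S \<subseteq> spc A closure_of ?S"
    unfolding invariant_def points_def by (simp add: closure_of_subset)
  then have "U \<subseteq> spc A interior_of (spc A closure_of ?S)"
    using S(1) U(1) by (simp add: interior_of_maximal)
  then have "dense_in_space (spc A) ?S"
    using assms S(2) U(2) unfolding topologically_transitive_def nowhere_dense_in_space_def by blast
  then have "?S \<inter> V \<noteq> {}"
    using V by (rule dense_meets_open)
  then show "\<exists>\<sigma>\<in>U. \<exists>\<tau>\<in>V. \<tau> \<in> orbit A \<sigma>"
    unfolding saturation_def by blast
qed

lemma recurrently_transitive_imp_open_invariant_dense:
  assumes "recurrently_transitive A"
  shows "open_invariant_dense A"
  unfolding open_invariant_dense_def dense_in_space_iff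
proof (intro allI impI, elim conjE)
  fix U V
  assume U: "openin (spc A) U" "invariant A U" "U \<noteq> {}" and V: "openin (spc A) V" "V \<noteq> {}"
  then obtain \<sigma> \<tau> where "\<sigma> \<in> U" "\<tau> \<in> V" "\<tau> \<in> orbit A \<sigma>"
    using assms unfolding recurrently_transitive_def recurrence_set_nonempty_iff by metis
  then show "U \<inter> V \<noteq> {}"
    using U(2) unfolding invariant_iff_orbits by auto
qed

lemma open_invariant_dense_imp_open_invariant_intersect:
  assumes "open_invariant_dense A"
  shows "open_invariant_intersect A"
  using assms dense_meets_open
  unfolding open_invariant_dense_def open_invariant_intersect_def by metis

lemma open_invariant_intersect_iff_not_union_of_closed_invariant:
  "open_invariant_intersect A \<longleftrightarrow> not_union_of_closed_invariant A"
proof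
  assume meet: "open_invariant_intersect A"
  show "not_union_of_closed_invariant A"
    unfolding not_union_of_closed_invariant_def
  proof (intro notI, elim exE conjE)
    fix C D
    assume C: "closedin (spc A) C" "invariant A C" "C \<noteq> points A"
      and D: "closedin (spc A) D" "invariant A D" "D \<noteq> points A"
      and CD: "points A = C \<union> D"
    have "openin (spc A) (points A - C)" "openin (spc A) (points A - D)"
      using C(1) D(1) unfolding points_def by (simp_all add: closedin_def)
    moreover have "points A - C \<noteq> {}" "points A - D \<noteq> {}"
      using C(3) D(3) CD by auto
    ultimately have "(points A - C) \<inter> (points A - D) \<noteq> {}"
      using meet invariant_complement[OF C(2)] invariant_complement[OF D(2)]
      unfolding open_invariant_intersect_def by blast
    then show False
      using CD by blast
  qed
next
  assume no_union: "not_union_of_closed_invariant A"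
  show "open_invariant_intersect A"
    unfolding open_invariant_intersect_def
  proof (intro allI impI notI, elim conjE)
    fix U V
    assume U: "openin (spc A) U" "invariant A U" "U \<noteq> {}"
      and V: "openin (spc A) V" "invariant A V" "V \<noteq> {}"
      and UV: "U \<inter> V = {}"
    have "closedin (spc A) (points A - U)" "closedin (spc A) (points A - V)"
      using U(1) V(1) unfolding points_def by (simp_all add: openin_closedin_eq)
    moreover have "points A - U \<noteq> points A" "points A - V \<noteq> points A"
      "points A = (points A - U) \<union> (points A - V)"
      using U(3) V(3) UV openin_subset_points[OF U(1)] openin_subset_points[OF V(1)] by auto
    ultimately show False
      using no_union invariant_complement[OF U(2)] invariant_complement[OF V(2)]
      unfolding not_union_of_closed_invariant_def by blast
  qed
qed

section \<open>Actions of open groupoids\<close>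

text \<open>Let \<open>\<xi>\<close> carry a point of \<open>U\<close> to \<open>\<tau>\<close>. By continuity, arrows near the inverse of \<open>\<xi>\<close> carry points
  near \<open>\<tau>\<close> into \<open>U\<close>, whenever they act on them. Openness of the source map guarantees that each
  point near \<open>\<tau>\<close> is acted on by such an arrow, so it lies in the saturation of \<open>U\<close>.\<close>

lemma openin_saturation:
  assumes "open_groupoid (gpd A)" "openin (spc A) U"
  shows "openin (spc A) (saturation A U)"
proof (subst openin_subopen, intro ballI)
  fix \<tau> assume "\<tau> \<in> saturation A U"
  then obtain \<sigma> where \<sigma>: "\<sigma> \<in> U" "\<tau> \<in> orbit A \<sigma>"
    unfolding saturation_def by blast
  have \<sigma>_point: "\<sigma> \<in> points A"
    using openin_subset_points[OF assms(2)] \<sigma>(1) by (rule subsetD)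
  have \<tau>_point: "\<tau> \<in> points A"
    using orbit_subset_points[OF \<sigma>_point] \<sigma>(2) by (rule subsetD)
  obtain \<eta> where \<eta>: "\<eta> \<in> arrows (gpd A)" "src (gpd A) \<eta> = anchor A \<tau>" "\<sigma> = act A \<eta> \<tau>"
    using orbit_sym[OF \<sigma>_point \<sigma>(2)] unfolding orbit_def by blast
  let ?comp = "{(\<xi>, \<sigma>). src (gpd A) \<xi> = anchor A \<sigma>}"
  let ?P = "prod_topology (arr_top (gpd A)) (spc A)"
  have "openin (subtopology ?P ?comp)
          {p \<in> topspace (subtopology ?P ?comp). (\<lambda>(\<xi>, \<sigma>). act A \<xi> \<sigma>) p \<in> U}"
    using continuous_map_act assms(2) by (rule openin_continuous_map_preimage)
  then obtain T where T: "openin ?P T"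
    "{p \<in> topspace (subtopology ?P ?comp). (\<lambda>(\<xi>, \<sigma>). act A \<xi> \<sigma>) p \<in> U} = T \<inter> ?comp"
    unfolding openin_subtopology by blast
  have "(\<eta>, \<tau>) \<in> T \<inter> ?comp"
    unfolding T(2)[symmetric] using \<eta> \<sigma>(1) \<tau>_point by (simp add: points_def arrows_def)
  then obtain N W where NW: "openin (arr_top (gpd A)) N" "openin (spc A) W"
    "\<eta> \<in> N" "\<tau> \<in> W" "N \<times> W \<subseteq> T"
    using T(1)[unfolded openin_prod_topology_alt, rule_format, of \<eta> \<tau>] by auto
  have act_in_U: "act A \<xi> \<upsilon> \<in> U" if "\<xi> \<in> N" "\<upsilon> \<in> W" "src (gpd A) \<xi> = anchor A \<upsilon>" for \<xi> \<upsilon>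
  proof -
    have "(\<xi>, \<upsilon>) \<in> T \<inter> ?comp"
      using NW(5) that by auto
    then show ?thesis
      unfolding T(2)[symmetric] by simp
  qed
  let ?W = "{\<upsilon> \<in> topspace (spc A). anchor A \<upsilon> \<in> src (gpd A) ` N} \<inter> W"
  have "openin (unit_top (gpd A)) (src (gpd A) ` N)"
    using assms(1) NW(1) unfolding open_groupoid_def open_map_def by blast
  then have "openin (spc A) ?W"
    using NW(2) by (intro openin_Int openin_continuous_map_preimage[OF continuous_map_anchor])
  moreover have "\<tau> \<in> ?W"
    using NW(3,4) \<eta>(2) \<tau>_point unfolding points_def by force
  moreover have "?W \<subseteq> saturation A U"
  proof
    fix \<upsilon> assume \<upsilon>: "\<upsilon> \<in> ?W"
    then obtain \<xi> where \<xi>: "\<xi> \<in> N" "src (gpd A) \<xi> = anchor A \<upsilon>"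
      by auto
    have "\<xi> \<in> arrows (gpd A)"
      using \<xi>(1) NW(1) openin_subset unfolding arrows_def by blast
    then have "act A \<xi> \<upsilon> \<in> orbit A \<upsilon>"
      unfolding orbit_def using \<xi>(2) by blast
    moreover have "\<upsilon> \<in> points A"
      using \<upsilon> unfolding points_def by blast
    ultimately have "\<upsilon> \<in> orbit A (act A \<xi> \<upsilon>)"
      by (rule orbit_sym[rotated])
    moreover have "act A \<xi> \<upsilon> \<in> U"
      using act_in_U[OF \<xi>(1) _ \<xi>(2)] \<upsilon> by blast
    ultimately show "\<upsilon> \<in> saturation A U"
      unfolding saturation_def by (rule UN_I[rotated])
  qed
  ultimately show "\<exists>T. openin (spc A) T \<and> \<tau> \<in> T \<and> T \<subseteq> saturation A U"
    by blast
qed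

lemma open_invariant_intersect_imp_topologically_transitive:
  assumes "open_groupoid (gpd A)" "open_invariant_intersect A"
  shows "topologically_transitive A"
  unfolding topologically_transitive_def
proof (intro allI impI, rule ccontr)
  fix M
  assume M: "invariant A M" and "\<not> (dense_in_space (spc A) M \<or> nowhere_dense_in_space (spc A) M)"
  then have "\<not> dense_in_space (spc A) M" and not_nowhere_dense: "\<not> nowhere_dense_in_space (spc A) M"
    by simp_all
  then obtain V where V: "openin (spc A) V" "V \<noteq> {}" "M \<inter> V = {}"
    unfolding dense_in_space_iff by auto
  let ?U = "spc A interior_of (spc A closure_of M)"
  have U: "openin (spc A) ?U" "?U \<noteq> {}" "?U \<subseteq> spc A closure_of M"
    using not_nowhere_dense
    by (simp_all add: nowhere_dense_in_space_def interior_of_subset)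
  note U_points = openin_subset_points[OF U(1)] and V_points = openin_subset_points[OF V(1)]
  have "saturation A ?U \<inter> saturation A V \<noteq> {}"
    using assms(2) openin_saturation[OF assms(1) U(1)] openin_saturation[OF assms(1) V(1)]
      invariant_saturation[OF U_points] invariant_saturation[OF V_points]
      subset_saturation[OF U_points] subset_saturation[OF V_points] U(2) V(2)
    unfolding open_invariant_intersect_def by (metis subset_empty)
  then obtain u v \<tau> where uv: "u \<in> ?U" "v \<in> V" "\<tau> \<in> orbit A u" "\<tau> \<in> orbit A v"
    unfolding saturation_def by blast
  have "u \<in> orbit A v"
    using orbit_trans[OF _ uv(4) orbit_sym[OF _ uv(3)]] uv(1,2) U_points V_points by auto
  then have "u \<in> saturation A V \<and> u \<in> spc A closure_of M"
    using uv(1,2) U(3) unfolding saturation_def by auto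
  then obtain m where m: "m \<in> M" "m \<in> saturation A V"
    using openin_saturation[OF assms(1) V(1)] unfolding in_closure_of by auto
  then obtain w where w: "w \<in> V" "m \<in> orbit A w"
    unfolding saturation_def by blast
  then have "w \<in> orbit A m"
    using orbit_sym[of w m] V_points by auto
  then have "w \<in> M"
    using M m(1) unfolding invariant_iff_orbits by blast
  then show False
    using w(1) V(3) by blast
qed

end

section \<open>The action of an equivalence relation\<close>

text \<open>A pair \<open>(x, y)\<close> in the relation is an arrow from \<open>y\<close> to \<open>x\<close>. Objects must be arrows, so the
  anchor embeds the space as the diagonal.\<close>

definition equivalence_action ::
    "('a::t2_space \<times> 'a) set \<Rightarrow> ('a \<times> 'a, 'a) groupoid_action" where
  "equivalence_action R =
     \<lparr>gpd = \<lparr>arr_top = top_of_set R,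
             src = (\<lambda>p. (snd p, snd p)), rng = (\<lambda>p. (fst p, fst p)),
             mul = (\<lambda>p q. (fst p, snd q)), iv = (\<lambda>p. (snd p, fst p))\<rparr>,
      spc = euclidean, anchor = (\<lambda>x. (x, x)), act = (\<lambda>p x. fst p)\<rparr>"

lemma Hausdorff_space_euclidean_t2: "Hausdorff_space (euclidean :: 'a::t2_space topology)"
  unfolding Hausdorff_space_def disjnt_def open_openin[symmetric]
  using hausdorff by metis

lemma continuous_groupoid_action_equivalence_action:
  assumes "equiv UNIV R"
  shows "continuous_groupoid_action (equivalence_action R)"
proof -
  have unit: "(x, x) \<in> R" for x
    using assms unfolding equiv_def refl_on_def by blast
  have inverse: "(snd p, fst p) \<in> R" if "p \<in> R" for p
    using assms that unfolding equiv_def by (metis prod.collapse symD)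
  have product: "(fst p, snd q) \<in> R" if "p \<in> R" "q \<in> R" "snd p = fst q" for p q
    using assms that unfolding equiv_def by (metis prod.collapse transD)
  have into_R: "continuous_map X (top_of_set R) (\<lambda>p. (f p, g p))"
    if "continuous_map X euclidean f" "continuous_map X euclidean g"
      "\<And>p. p \<in> topspace X \<Longrightarrow> (f p, g p) \<in> R" for X :: "'z topology" and f g
    using that continuous_map_pairedI[OF that(1,2)]
    by (auto simp: continuous_map_in_subtopology euclidean_product_topology)
  have fst_R: "continuous_map (top_of_set R) euclidean fst"
    and snd_R: "continuous_map (top_of_set R) euclidean snd"
    by (auto intro!: continuous_intros)
  let ?A = "equivalence_action R"
  let ?G = "gpd ?A"
  have arr: "arr_top ?G = top_of_set R" "arrows ?G = R"
    by (simp_all add: equivalence_action_def arrows_def)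
  have units: "units ?G = range (\<lambda>x. (x, x))"
  proof
    show "units ?G \<subseteq> range (\<lambda>x. (x, x))"
      unfolding units_def by (auto simp: equivalence_action_def)
    show "range (\<lambda>x. (x, x)) \<subseteq> units ?G"
      using imageI[OF unit, of "src ?G"] unfolding units_def arr
      by (auto simp: equivalence_action_def)
  qed
  have "groupoid ?G"
    unfolding groupoid_def arr
    by (simp add: equivalence_action_def unit inverse product)
  moreover have "Hausdorff_space (arr_top ?G)"
    unfolding arr by (intro Hausdorff_space_subtopology Hausdorff_space_euclidean_t2)
  moreover have "continuous_map (arr_top ?G) (arr_top ?G) (iv ?G)"
    unfolding arr using into_R[OF snd_R fst_R] inverse by (simp add: equivalence_action_def)
  moreover have "continuous_map
       (subtopology (prod_topology (arr_top ?G) (arr_top ?G)) {(\<xi>, \<eta>). src ?G \<xi> = rng ?G \<eta>})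
       (arr_top ?G) (\<lambda>(\<xi>, \<eta>). mul ?G \<xi> \<eta>)"
    (is "continuous_map ?composable _ _")
  proof -
    have "continuous_map (top_of_set (R \<times> R)) euclidean (\<lambda>p. fst (fst p))"
      "continuous_map (top_of_set (R \<times> R)) euclidean (\<lambda>p. snd (snd p))"
      by (auto intro!: continuous_intros)
    then have "continuous_map ?composable euclidean (\<lambda>p. fst (fst p))"
      "continuous_map ?composable euclidean (\<lambda>p. snd (snd p))"
      by (simp_all add: arr continuous_map_from_subtopology)
    then have "continuous_map ?composable (top_of_set R) (\<lambda>p. (fst (fst p), snd (snd p)))"
      by (rule into_R) (auto simp: arr equivalence_action_def intro: product)
    then show ?thesis
      by (simp add: arr equivalence_action_def case_prod_unfold)
  qed
  ultimately have "topological_groupoid ?G"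
    unfolding topological_groupoid_def by blast
  moreover have "continuous_map (spc ?A) (unit_top ?G) (anchor ?A)"
  proof -
    have "continuous_map euclidean (top_of_set R) (\<lambda>x. (x, x))"
      by (intro into_R) (simp_all add: unit)
    then show ?thesis
      unfolding unit_top_def units arr
      by (simp add: continuous_map_in_subtopology equivalence_action_def)
  qed
  moreover have "continuous_map
       (subtopology (prod_topology (arr_top ?G) (spc ?A)) {(\<xi>, \<sigma>). src ?G \<xi> = anchor ?A \<sigma>})
       (spc ?A) (\<lambda>(\<xi>, \<sigma>). act ?A \<xi> \<sigma>)"
    unfolding arr
    using continuous_map_from_subtopology[OF continuous_map_compose[OF continuous_map_fst fst_R]]
    by (simp add: equivalence_action_def case_prod_unfold comp_def)
  moreover have "Hausdorff_space (spc ?A)" "anchor ?A ` points ?A = units ?G"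
    unfolding units by (simp_all add: equivalence_action_def points_def Hausdorff_space_euclidean_t2)
  ultimately show ?thesis
    unfolding continuous_groupoid_action_def by (auto simp: equivalence_action_def)
qed

lemma spc_equivalence_action [simp]: "spc (equivalence_action R) = euclidean"
  by (simp add: equivalence_action_def)

lemma points_equivalence_action [simp]: "points (equivalence_action R) = UNIV"
  by (simp add: points_def)

lemma orbit_equivalence_action: "orbit (equivalence_action R) x = {y. (y, x) \<in> R}"
  by (force simp: orbit_def equivalence_action_def arrows_def)

text \<open>Presenting the relation as the kernel of a labelling of the points leaves no equivalence
  axioms to check in the examples.\<close>

definition fibre_relation :: "('a \<Rightarrow> 'b) \<Rightarrow> ('a \<times> 'a) set" where
  "fibre_relation f = {(x, y). f x = f y}"

lemma continuous_groupoid_action_fibre_relation: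
  "continuous_groupoid_action (equivalence_action (fibre_relation f))"
  by (intro continuous_groupoid_action_equivalence_action)
    (auto simp: fibre_relation_def equiv_def refl_on_def sym_def trans_def)

lemma orbit_fibre_relation: "orbit (equivalence_action (fibre_relation f)) x = {y. f y = f x}"
  by (simp add: orbit_equivalence_action fibre_relation_def)

lemma invariant_fibre_relation_iff:
  "invariant (equivalence_action (fibre_relation f)) M \<longleftrightarrow> (\<forall>x\<in>M. \<forall>y. f y = f x \<longrightarrow> y \<in> M)"
  by (auto simp: invariant_iff_orbits orbit_fibre_relation)

section \<open>Counterexamples on the real line\<close>

lemma half_lines_intersect_not_dense:
  defines "A \<equiv> equivalence_action (fibre_relation (\<lambda>x::real. x \<le> 0))"
  shows "open_invariant_intersect A" "\<not> open_invariant_dense A"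
proof -
  have "1 \<in> U" if U: "open U" "invariant A U" "U \<noteq> {}" for U
  proof -
    have "\<exists>x\<in>U. x > 0"
    proof (rule ccontr)
      assume "\<not> (\<exists>x\<in>U. x > 0)"
      \<comment> \<open>Then \<open>U\<close> contains the other class, hence the point 0, which is not interior to that class.\<close>
      then have "0 \<in> U"
        using U(2,3) unfolding A_def invariant_fibre_relation_iff by force
      then obtain e where "e > 0" "ball 0 e \<subseteq> U"
        using U(1) open_contains_ball by blast
      then have "e / 2 \<in> U"
        by (auto simp: subset_iff)
      then show False
        using \<open>e > 0\<close> \<open>\<not> (\<exists>x\<in>U. x > 0)\<close> by force
    qed
    then show "1 \<in> U"
      using U(2) unfolding A_def invariant_fibre_relation_iff by force
  qed
  then show "open_invariant_intersect A"
    unfolding open_invariant_intersect_def by (auto simp: A_def)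
  have "invariant A {0<..}"
    by (auto simp: A_def invariant_fibre_relation_iff)
  moreover have "{0<..} \<inter> {..<0::real} = {}" "{..<0::real} \<noteq> {}" "{0::real<..} \<noteq> {}"
    by auto
  ultimately show "\<not> open_invariant_dense A"
    unfolding open_invariant_dense_def dense_in_space_iff
    by (metis A_def open_greaterThan open_lessThan open_openin spc_equivalence_action)
qed

lemma interlocked_half_lines_dense_not_recurrent:
  defines "A \<equiv> equivalence_action (fibre_relation (\<lambda>x::real. x < 0 \<or> x = 2))"
  shows "open_invariant_dense A" "\<not> recurrently_transitive A"
proof -
  have "U = UNIV" if U: "open U" "invariant A U" "U \<noteq> {}" for U
  proof -
    have same_class: "y \<in> U" if "x \<in> U" "(y < 0 \<or> y = 2) = (x < 0 \<or> x = 2)" for x y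
      using U(2) that unfolding A_def invariant_fibre_relation_iff by metis
    obtain x where "x \<in> U"
      using U(3) by auto
    then have "0 \<in> U \<or> 2 \<in> U"
      using same_class[of x 0] same_class[of x 2] by (cases "x < 0 \<or> x = 2") simp_all
    \<comment> \<open>The points 0 and 2 lie in different classes, and each is a limit of points of the other's
      class, here from the left.\<close>
    then have "0 \<in> U \<and> 2 \<in> U"
    proof
      assume "0 \<in> U"
      then obtain e where "e > 0" "ball 0 e \<subseteq> U"
        using U(1) open_contains_ball by blast
      then have "- e / 2 \<in> U" "- e / 2 < 0"
        by (auto simp: subset_iff)
      then show ?thesis
        using same_class[of "- e / 2" 2] \<open>0 \<in> U\<close> by simp
    next
      assume "2 \<in> U"
      then obtain e where e: "e > 0" "ball 2 e \<subseteq> U"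
        using U(1) open_contains_ball by blast
      define x where "x = 2 - min (e / 2) 1"
      have "x \<in> ball 2 e" "x \<ge> 0" "x \<noteq> 2"
        using e(1) by (auto simp: x_def dist_real_def)
      then have "x \<in> U" "\<not> (x < 0 \<or> x = 2)"
        using e(2) by auto
      then show ?thesis
        using same_class[of x 0] \<open>2 \<in> U\<close> by simp
    qed
    then have "y \<in> U" for y
      using same_class[of 0 y] same_class[of 2 y] by (cases "y < 0 \<or> y = 2") simp_all
    then show "U = UNIV"
      by auto
  qed
  then show "open_invariant_dense A"
    unfolding open_invariant_dense_def dense_in_space_iff by (auto simp: A_def)
  have "recurrence_set A {..<0} {0<..<1} = {}"
    using recurrence_set_nonempty_iff[of A "{..<0}" "{0<..<1}"]
    by (auto simp: A_def orbit_fibre_relation)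
  moreover have "openin (spc A) {..<0}" "openin (spc A) {0<..<1}"
    by (simp_all add: A_def)
  moreover have "{..<0::real} \<noteq> {}" "{0<..<1::real} \<noteq> {}"
    by auto
  ultimately show "\<not> recurrently_transitive A"
    unfolding recurrently_transitive_def by metis
qed

lemma open_meets_Rats_and_irrationals:
  fixes U :: "real set"
  assumes "open U" "U \<noteq> {}"
  shows "\<rat> \<inter> U \<noteq> {}" "U - \<rat> \<noteq> {}"
proof -
  show "\<rat> \<inter> U \<noteq> {}"
    using assms open_Int_closure_eq_empty[of U \<rat>] by (simp add: Rats_closure_real Int_commute)
  show "U - \<rat> \<noteq> {}"
    using open_minus_countable[OF countable_rat assms(2,1)] by blast
qed

text \<open>Labelling the rationals by 0 and each irrational by itself makes the rationals one class and
  the irrationals singleton classes, since 0 is rational.\<close>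

lemma rational_class_pointwise_not_topologically_transitive:
  defines "A \<equiv> equivalence_action (fibre_relation (\<lambda>x::real. if x \<in> \<rat> then 0 else x))"
  shows "pointwise_transitive A" "\<not> topologically_transitive A"
proof -
  have "orbit A 0 = \<rat>"
    by (auto simp: A_def orbit_fibre_relation)
  then show "pointwise_transitive A"
    unfolding pointwise_transitive_def dense_in_space_iff
    using open_meets_Rats_and_irrationals(1) by (auto simp: A_def intro!: exI[of _ 0])
  define M :: "real set" where "M = {0<..<1} - \<rat>"
  have "invariant A M"
    by (auto simp: A_def M_def invariant_fibre_relation_iff split: if_splits)
  moreover have "\<not> dense_in_space euclidean M"
  proof -
    have "M \<inter> {1<..} = {}" "openin euclidean {1::real<..}" "{1::real<..} \<noteq> {}"
      by (auto simp: M_def)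
    then show ?thesis
      using dense_meets_open by metis
  qed
  moreover have "\<not> nowhere_dense_in_space euclidean M"
  proof -
    have "open ({0<..<1} - closure M)"
      by (intro open_Diff) simp_all
    moreover have "({0<..<1} - closure M) - \<rat> = {}"
      using closure_subset[of M] unfolding M_def by auto
    ultimately have "{0<..<1} - closure M = {}"
      using open_meets_Rats_and_irrationals(2) by metis
    then have "{0<..<1} \<subseteq> closure M"
      by simp
    then have "1 / 2 \<in> interior (closure M)"
      using interior_maximal[of "{0<..<1}" "closure M"] by auto
    then show ?thesis
      unfolding nowhere_dense_in_space_def by auto
  qed
  ultimately show "\<not> topologically_transitive A"
    unfolding topologically_transitive_def by (auto simp: A_def)
qed

section \<open>Relations between the transitivity conditions\<close>

theorem theorem4p1:
  shows
   "(\<forall>A :: ('g, 's) groupoid_action. continuous_groupoid_action A \<longrightarrow>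
       (transitive_action A \<longrightarrow> pointwise_transitive A) \<and>
       (pointwise_transitive A \<longrightarrow> recurrently_transitive A)) \<and>
    (\<forall>A :: ('g, 's) groupoid_action. continuous_groupoid_action A \<longrightarrow>
       (topologically_transitive A \<longrightarrow> recurrently_transitive A) \<and>
       (recurrently_transitive A \<longrightarrow> open_invariant_dense A) \<and>
       (open_invariant_dense A \<longrightarrow> open_invariant_intersect A) \<and>
       (open_invariant_intersect A \<longleftrightarrow> not_union_of_closed_invariant A)) \<and>
    (\<exists>A :: (real \<times> real, real) groupoid_action. continuous_groupoid_action A \<and>
       not_union_of_closed_invariant A \<and> \<not> open_invariant_dense A) \<and>
    (\<exists>A :: (real \<times> real, real) groupoid_action. continuous_groupoid_action A \<and>
       open_invariant_dense A \<and> \<not> recurrently_transitive A) \<and>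
    (\<exists>A :: (real \<times> real, real) groupoid_action. continuous_groupoid_action A \<and>
       recurrently_transitive A \<and> \<not> topologically_transitive A) \<and>
    (\<exists>A :: (real \<times> real, real) groupoid_action. continuous_groupoid_action A \<and>
       pointwise_transitive A \<and> \<not> topologically_transitive A) \<and>
    (\<forall>A :: ('g, 's) groupoid_action. continuous_groupoid_action A \<and> open_groupoid (gpd A) \<longrightarrow>
       (not_union_of_closed_invariant A \<longleftrightarrow> open_invariant_intersect A) \<and>
       (open_invariant_intersect A \<longleftrightarrow> open_invariant_dense A) \<and>
       (open_invariant_dense A \<longleftrightarrow> recurrently_transitive A) \<and>
       (recurrently_transitive A \<longleftrightarrow> topologically_transitive A))"
proof (intro conjI)
  show "\<forall>A :: ('g, 's) groupoid_action. continuous_groupoid_action A \<longrightarrow>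
       (transitive_action A \<longrightarrow> pointwise_transitive A) \<and>
       (pointwise_transitive A \<longrightarrow> recurrently_transitive A)"
    using continuous_action.transitive_imp_pointwise_transitive
      continuous_action.pointwise_transitive_imp_recurrently_transitive continuous_action.intro
    by blast
  show "\<forall>A :: ('g, 's) groupoid_action. continuous_groupoid_action A \<longrightarrow>
       (topologically_transitive A \<longrightarrow> recurrently_transitive A) \<and>
       (recurrently_transitive A \<longrightarrow> open_invariant_dense A) \<and>
       (open_invariant_dense A \<longrightarrow> open_invariant_intersect A) \<and>
       (open_invariant_intersect A \<longleftrightarrow> not_union_of_closed_invariant A)"
    using continuous_action.topologically_transitive_imp_recurrently_transitive
      continuous_action.recurrently_transitive_imp_open_invariant_dense
      continuous_action.open_invariant_dense_imp_open_invariant_intersect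
      continuous_action.open_invariant_intersect_iff_not_union_of_closed_invariant
      continuous_action.intro
    by metis
  show "\<exists>A :: (real \<times> real, real) groupoid_action. continuous_groupoid_action A \<and>
       not_union_of_closed_invariant A \<and> \<not> open_invariant_dense A"
    using continuous_groupoid_action_fibre_relation half_lines_intersect_not_dense
      continuous_action.open_invariant_intersect_iff_not_union_of_closed_invariant
      continuous_action.intro
    by metis
  show "\<exists>A :: (real \<times> real, real) groupoid_action. continuous_groupoid_action A \<and>
       open_invariant_dense A \<and> \<not> recurrently_transitive A"
    using continuous_groupoid_action_fibre_relation interlocked_half_lines_dense_not_recurrent by blast
  show "\<exists>A :: (real \<times> real, real) groupoid_action. continuous_groupoid_action A \<and>
       recurrently_transitive A \<and> \<not> topologically_transitive A"
    using continuous_groupoid_action_fibre_relation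
      continuous_action.pointwise_transitive_imp_recurrently_transitive[OF
        continuous_action.intro[OF continuous_groupoid_action_fibre_relation]
        rational_class_pointwise_not_topologically_transitive(1)]
      rational_class_pointwise_not_topologically_transitive(2)
    by blast
  show "\<exists>A :: (real \<times> real, real) groupoid_action. continuous_groupoid_action A \<and>
       pointwise_transitive A \<and> \<not> topologically_transitive A"
    using continuous_groupoid_action_fibre_relation rational_class_pointwise_not_topologically_transitive
    by blast
  show "\<forall>A :: ('g, 's) groupoid_action. continuous_groupoid_action A \<and> open_groupoid (gpd A) \<longrightarrow>
       (not_union_of_closed_invariant A \<longleftrightarrow> open_invariant_intersect A) \<and>
       (open_invariant_intersect A \<longleftrightarrow> open_invariant_dense A) \<and>
       (open_invariant_dense A \<longleftrightarrow> recurrently_transitive A) \<and>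
       (recurrently_transitive A \<longleftrightarrow> topologically_transitive A)"
  proof (intro allI impI, elim conjE)
    fix A :: "('g, 's) groupoid_action"
    assume "continuous_groupoid_action A" and op: "open_groupoid (gpd A)"
    then interpret continuous_action A
      by (simp add: continuous_action.intro)
    show "(not_union_of_closed_invariant A \<longleftrightarrow> open_invariant_intersect A) \<and>
       (open_invariant_intersect A \<longleftrightarrow> open_invariant_dense A) \<and>
       (open_invariant_dense A \<longleftrightarrow> recurrently_transitive A) \<and>
       (recurrently_transitive A \<longleftrightarrow> topologically_transitive A)"
      using open_invariant_intersect_iff_not_union_of_closed_invariant
        open_invariant_intersect_imp_topologically_transitive[OF op]
        topologically_transitive_imp_recurrently_transitive
        recurrently_transitive_imp_open_invariant_dense
        open_invariant_dense_imp_open_invariant_intersect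
      by blast
  qed
qed

end
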